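(* Let $d\ge 2$ and $T^d=\operatorname{conv}\{e_1,\dots,e_{d+1}\}\subset\mathbb{R}^{d+1}$ be the regular $d$-simplex of edge length $\sqrt2$. For every $j\in\{1,\dots,d\}$, $$R_j(T^d)\ \ge\ \sqrt{\frac{j}{d+1}},$$ and equality holds if and only if there exists a good subset basis (gsb) $\{s_1,\dots,s_j\}$ of $j$ vectors in $\mathbb{R}^{d+1}$.
   Context: For a body $C$ (bounded, closed, convex set with nonempty interior) in $d$-dimensional Euclidean space and $1\le j\le d$, the outer $j$-radius is $R_j(C)=\min\{\rho\ge 0: C\subset E+\rho\mathbb{B}\text{ for some }(d-j)\text{-dimensional affine subspace }E\}$, where $\mathbb{B}$ is the Euclidean unit ball; equivalently, it is the smallest radius of a ball containing the orthogonal projection of $C$ onto some $j$-dimensional linear subspace. The simplex $T^d$ lies in the hyperplane $\{x\in\mathbb{R}^{d+1}:\sum_k x_k=1\}$ and is regarded as a body in this $d$-dimensional Euclidean space; so projections are taken onto $j$-dimensional subspaces of the parallel linear hyperplane $\{x\in\mathbb{R}^{d+1}:\sum_k x_k=0\}$. Write $s_{lk}$ for the $k$-th coordinate of $s_l$. A set of orthonormal vectors $\{s_1,\dots,s_j\}$ in $\mathbb{R}^{d+1}$, $1\le j\le d$, is a good subset basis (gsb) if $\sum_{k=1}^{d+1}s_{lk}=0$ for all $l\in\{1,\dots,j\}$ and $\sum_{l=1}^{j}s_{lk}^2=\frac{j}{d+1}$ for all $k\in\{1,\dots,d+1\}$. *)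

theory Defs
  imports "HOL-Analysis.Analysis"
begin

definition direction_space :: "'a::euclidean_space set \<Rightarrow> 'a set" where
  "direction_space H = {x - y | x y. x \<in> H \<and> y \<in> H}"

text \<open>The outer \<open>j\<close>-radius of \<open>C\<close>, where \<open>C\<close> is regarded as a subset of the Euclidean space
  given by an affine subspace \<open>H\<close>: the flats \<open>E\<close> lie in \<open>H\<close> and have codimension \<open>j\<close> in \<open>H\<close>, and
  the unit ball is that of the linear space parallel to \<open>H\<close>. The minimum is rendered by \<open>LEAST\<close>,
  which is meaningful only if it is attained (as it is for nonempty bounded \<open>C \<subseteq> H\<close> and
  \<open>j \<le> aff_dim H\<close>).\<close>

definition outer_radius :: "'a::euclidean_space set \<Rightarrow> nat \<Rightarrow> 'a set \<Rightarrow> real" where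
  "outer_radius H j C =
    (LEAST \<rho>. 0 \<le> \<rho> \<and>
      (\<exists>E. affine E \<and> E \<subseteq> H \<and> aff_dim E = aff_dim H - int j \<and>
        C \<subseteq> {e + \<rho> *\<^sub>R b | e b. e \<in> E \<and> b \<in> cball 0 1 \<inter> direction_space H}))"

definition simplex_hyperplane :: "(real ^ 'n) set" where
  "simplex_hyperplane = {x. (\<Sum>k\<in>UNIV. x $ k) = 1}"

definition regular_simplex :: "(real ^ 'n) set" where
  "regular_simplex = convex hull (range (\<lambda>k. axis k 1))"

definition good_subset_basis :: "nat \<Rightarrow> (real ^ 'n) set \<Rightarrow> bool" where
  "good_subset_basis j S \<longleftrightarrow>
    1 \<le> j \<and> j \<le> CARD('n) - 1 \<and>
    finite S \<and> card S = j \<and>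
    pairwise orthogonal S \<and> (\<forall>s\<in>S. norm s = 1) \<and>
    (\<forall>s\<in>S. (\<Sum>k\<in>UNIV. s $ k) = 0) \<and>
    (\<forall>k. (\<Sum>s\<in>S. (s $ k)\<^sup>2) = real j / real CARD('n))"

end

theory Submission
  imports Defs
begin

text \<open>
  A flat of codimension \<open>j\<close> in \<open>H\<close> is cut out by equations \<open>s \<bullet> x = c s\<close> for \<open>s\<close> in an orthonormal
  set \<open>S\<close> of \<open>j\<close> directions of \<open>H\<close>, and the squared distance of \<open>x\<close> to it is
  \<open>\<Sum>s\<in>S. (s \<bullet> x - c s)\<^sup>2\<close>. For the simplex only the vertices \<open>e\<^sub>k\<close> matter, and since the
  coordinates of each \<open>s\<close> sum to \<open>0\<close> and their squares to \<open>1\<close>, the squared distances of the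
  \<open>d + 1\<close> vertices add up to \<open>j + (d + 1) * (\<Sum>s\<in>S. (c s)\<^sup>2)\<close>. Hence their maximum is at least
  \<open>j / (d + 1)\<close>, with equality exactly if \<open>c = 0\<close> and all distances agree, that is, if \<open>S\<close> is a
  good subset basis. That the minimum in the definition of the outer radius is attained follows
  from compactness of the set of all admissible \<open>(\<rho>, S, c)\<close> with \<open>\<rho>\<close> bounded.
\<close>

definition orthonormal :: "'a::real_inner set \<Rightarrow> bool" where
  "orthonormal S \<longleftrightarrow> pairwise orthogonal S \<and> (\<forall>s\<in>S. norm s = 1)"

text \<open>The predicate whose least \<open>\<rho>\<close> is \<open>outer_radius\<close>, named so
  that it can be characterised apart from \<open>LEAST\<close>.\<close>

definition covered_by_cylinder :: "'a::euclidean_space set \<Rightarrow> nat \<Rightarrow> 'a set \<Rightarrow> real \<Rightarrow> bool" where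
  "covered_by_cylinder H j C \<rho> \<longleftrightarrow> 0 \<le> \<rho> \<and>
     (\<exists>E. affine E \<and> E \<subseteq> H \<and> aff_dim E = aff_dim H - int j \<and>
        C \<subseteq> {e + \<rho> *\<^sub>R b | e b. e \<in> E \<and> b \<in> cball 0 1 \<inter> direction_space H})"

section \<open>Finite orthonormal sets and Bessel's inequality\<close>

lemma orthonormal_inner:
  assumes "orthonormal S" "s \<in> S" "t \<in> S"
  shows "s \<bullet> t = (if s = t then 1 else 0)"
  using assms by (auto simp: orthonormal_def pairwise_def orthogonal_def norm_eq_1)

lemma orthonormal_independent: "orthonormal S \<Longrightarrow> independent S"
  by (rule pairwise_orthogonal_independent) (auto simp: orthonormal_def)

lemma orthonormal_subset: "orthonormal S \<Longrightarrow> T \<subseteq> S \<Longrightarrow> orthonormal T"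
  by (auto simp: orthonormal_def intro: pairwise_subset)

lemma subspace_orthonormal_basis:
  fixes U :: "'a::euclidean_space set"
  assumes "subspace U"
  obtains S where "S \<subseteq> U" "orthonormal S" "finite S" "card S = dim U" "span S = U"
proof -
  obtain S where S: "S \<subseteq> U" "pairwise orthogonal S" "\<And>x. x \<in> S \<Longrightarrow> norm x = 1"
    "independent S" "card S = dim U" "span S = U"
    using orthonormal_basis_subspace[OF assms] by metis
  then show ?thesis
    using that[of S] independent_imp_finite[of S] by (auto simp: orthonormal_def)
qed

lemma inner_orthonormal_sum:
  assumes "orthonormal S" "finite S" "t \<in> S"
  shows "t \<bullet> (\<Sum>s\<in>S. a s *\<^sub>R s) = a t"
proof -
  have "t \<bullet> (\<Sum>s\<in>S. a s *\<^sub>R s) = (\<Sum>s\<in>S. if t = s then a s else 0)"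
    unfolding inner_sum_right
    using assms by (intro sum.cong) (auto simp: orthonormal_inner)
  then show ?thesis
    using assms by simp
qed

lemma norm_orthonormal_sum:
  assumes "orthonormal S" "finite S"
  shows "(norm (\<Sum>s\<in>S. a s *\<^sub>R s))\<^sup>2 = (\<Sum>s\<in>S. (a s)\<^sup>2)"
proof -
  have "(norm (\<Sum>s\<in>S. a s *\<^sub>R s))\<^sup>2 = (\<Sum>t\<in>S. a t * (t \<bullet> (\<Sum>s\<in>S. a s *\<^sub>R s)))"
    by (simp add: power2_norm_eq_inner inner_sum_left)
  then show ?thesis
    using assms by (simp add: inner_orthonormal_sum power2_eq_square)
qed

lemma bessel_inequality:
  assumes "orthonormal S" "finite S"
  shows "(\<Sum>s\<in>S. (s \<bullet> x)\<^sup>2) \<le> (norm x)\<^sup>2"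
proof -
  let ?y = "\<Sum>s\<in>S. (s \<bullet> x) *\<^sub>R s"
  have 1: "(norm ?y)\<^sup>2 = (\<Sum>s\<in>S. (s \<bullet> x)\<^sup>2)"
    by (rule norm_orthonormal_sum[OF assms])
  have "?y \<bullet> x = (\<Sum>s\<in>S. (s \<bullet> x)\<^sup>2)"
    by (simp add: inner_sum_left power2_eq_square)
  then have "(norm ?y)\<^sup>2 \<le> norm ?y * norm x"
    using norm_cauchy_schwarz[of ?y x] 1 by simp
  then have "norm ?y \<le> norm x"
    by (cases "norm ?y = 0") (simp_all add: power2_eq_square)
  then show ?thesis
    using power_mono[OF _ norm_ge_zero, of ?y "norm x" 2] 1 by simp
qed

section \<open>Directions of affine sets and orthonormal equations of flats\<close>

lemma direction_space_eq:
  assumes "affine H" "p \<in> H"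
  shows "direction_space H = (\<lambda>x. x - p) ` H"
proof (intro equalityI subsetI)
  fix z assume "z \<in> direction_space H"
  then obtain x y where xy: "z = x - y" "x \<in> H" "y \<in> H"
    by (auto simp: direction_space_def)
  have "p + 1 *\<^sub>R (x - y) \<in> H"
    using mem_affine_3_minus[OF assms(1) assms(2) xy(2,3), of 1] by simp
  then show "z \<in> (\<lambda>x. x - p) ` H"
    using xy by (intro image_eqI[of _ _ "p + (x - y)"]) auto
qed (use assms in \<open>auto simp: direction_space_def\<close>)

lemma subspace_direction_space:
  assumes "affine H" "p \<in> H"
  shows "subspace (direction_space H)"
  using affine_diffs_subspace_subtract[OF assms] direction_space_eq[OF assms] by simp

lemma dim_direction_space:
  assumes "affine H" "p \<in> H"
  shows "int (dim (direction_space H)) = aff_dim H"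
  using aff_dim_dim_affine_diffs[OF assms] direction_space_eq[OF assms] by simp

lemma add_direction_space:
  assumes "affine H" "p \<in> H" "v \<in> direction_space H"
  shows "p + v \<in> H"
  using assms(3) unfolding direction_space_eq[OF assms(1,2)] by auto

text \<open>A flat \<open>E\<close> of codimension \<open>j\<close> in \<open>H\<close> corresponds
  to an orthonormal basis \<open>S\<close> of the orthogonal complement of its directions within
  those of \<open>H\<close>, together with the constant values \<open>c s\<close> of
  \<open>s \<bullet> x\<close> on \<open>E\<close>. This replaces the choice of a flat by the choice
  of finitely many vectors and numbers.\<close>

lemma covered_by_cylinder_iff:
  fixes H C :: "'a::euclidean_space set"
  assumes H: "affine H" and C: "C \<subseteq> H" and j: "int j \<le> aff_dim H" and \<rho>: "0 \<le> \<rho>"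
  shows "covered_by_cylinder H j C \<rho> \<longleftrightarrow>
    (\<exists>S c. finite S \<and> card S = j \<and> orthonormal S \<and> S \<subseteq> direction_space H \<and>
       (\<forall>x\<in>C. (\<Sum>s\<in>S. (s \<bullet> x - c s)\<^sup>2) \<le> \<rho>\<^sup>2))"
proof
  assume "covered_by_cylinder H j C \<rho>"
  then obtain E where E: "affine E" "E \<subseteq> H" "aff_dim E = aff_dim H - int j"
    and cov: "C \<subseteq> {e + \<rho> *\<^sub>R b | e b. e \<in> E \<and> b \<in> cball 0 1 \<inter> direction_space H}"
    by (auto simp: covered_by_cylinder_def)
  have "E \<noteq> {}"
    using E(3) j by auto
  then obtain p where p: "p \<in> E" by auto
  then have pH: "p \<in> H" using E by auto
  let ?L = "direction_space E" and ?U = "direction_space H"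
  \<comment> \<open>The orthogonal complement of the directions of \<open>E\<close> inside those of
    \<open>H\<close>; its dimension is the codimension \<open>j\<close>.\<close>
  let ?M = "{y \<in> ?U. \<forall>x\<in>?L. orthogonal x y}"
  have LU: "?L \<subseteq> ?U"
    using E(2) by (auto simp: direction_space_def)
  have sL: "subspace ?L" and sU: "subspace ?U"
    using subspace_direction_space E(1) H p pH by auto
  have "subspace ?M"
    using sU by (auto simp: subspace_def orthogonal_def inner_add_right)
  then obtain S where S: "S \<subseteq> ?M" "orthonormal S" "finite S" "card S = dim ?M"
    by (metis (no_types, lifting) subspace_orthonormal_basis)
  have "dim ?M + dim ?L = dim ?U"
    by (rule dim_subspace_orthogonal_to_vectors[OF sL sU LU])
  then have card: "card S = j"
    using S(4) dim_direction_space[OF E(1) p] dim_direction_space[OF H pH] E(3) by linarith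
  have "(\<Sum>s\<in>S. (s \<bullet> x - s \<bullet> p)\<^sup>2) \<le> \<rho>\<^sup>2" if xC: "x \<in> C" for x
  proof -
    obtain e b where x: "x = e + \<rho> *\<^sub>R b" "e \<in> E" "norm b \<le> 1"
      using subsetD[OF cov xC] by auto
    \<comment> \<open>Both \<open>e\<close> and \<open>p\<close> lie in \<open>E\<close>, so
      \<open>s\<close> does not distinguish them and only the offset
      \<open>\<rho> *\<^sub>R b\<close> contributes. Bessel's inequality for \<open>b\<close> then
      gives the bound.\<close>
    have "s \<bullet> x - s \<bullet> p = \<rho> * (s \<bullet> b)" if "s \<in> S" for s
    proof -
      have "e - p \<in> ?L"
        using x(2) p by (auto simp: direction_space_def)
      then have "(e - p) \<bullet> s = 0"
        using S(1) that by (auto simp: orthogonal_def)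
      then show ?thesis
        by (simp add: x(1) algebra_simps inner_commute)
    qed
    then have "(\<Sum>s\<in>S. (s \<bullet> x - s \<bullet> p)\<^sup>2) = \<rho>\<^sup>2 * (\<Sum>s\<in>S. (s \<bullet> b)\<^sup>2)"
      by (simp add: power_mult_distrib sum_distrib_left)
    also have "\<dots> \<le> \<rho>\<^sup>2 * 1"
      using order_trans[OF bessel_inequality[OF S(2,3)] power_le_one[OF norm_ge_zero x(3)]]
      by (intro mult_left_mono) auto
    finally show ?thesis by simp
  qed
  then show "\<exists>S c. finite S \<and> card S = j \<and> orthonormal S \<and> S \<subseteq> ?U \<and>
       (\<forall>x\<in>C. (\<Sum>s\<in>S. (s \<bullet> x - c s)\<^sup>2) \<le> \<rho>\<^sup>2)"
    using S card by (intro exI[of _ S] exI[of _ "\<lambda>s. s \<bullet> p"]) auto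
next
  let ?U = "direction_space H"
  assume "\<exists>S c. finite S \<and> card S = j \<and> orthonormal S \<and> S \<subseteq> ?U \<and>
       (\<forall>x\<in>C. (\<Sum>s\<in>S. (s \<bullet> x - c s)\<^sup>2) \<le> \<rho>\<^sup>2)"
  then obtain S c where S: "finite S" "card S = j" "orthonormal S" "S \<subseteq> ?U"
    and le: "\<And>x. x \<in> C \<Longrightarrow> (\<Sum>s\<in>S. (s \<bullet> x - c s)\<^sup>2) \<le> \<rho>\<^sup>2"
    by auto
  have "H \<noteq> {}" using j by auto
  then obtain q where q: "q \<in> H" by auto
  have sU: "subspace ?U"
    by (rule subspace_direction_space[OF H q])
  \<comment> \<open>The displacement of \<open>x\<close> from its orthogonal projection onto the
    flat; its squared norm is the sum in the hypothesis.\<close>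
  define r where "r x = (\<Sum>s\<in>S. (s \<bullet> x - c s) *\<^sub>R s)" for x
  have rU: "r x \<in> ?U" for x
    unfolding r_def using S(4) by (intro subspace_sum[OF sU] subspace_scale[OF sU]) auto
  have sr: "s \<bullet> r x = s \<bullet> x - c s" if "s \<in> S" for s x
    unfolding r_def by (rule inner_orthonormal_sum[OF S(3,1) that])
  define E where "E = {x \<in> H. \<forall>s\<in>S. s \<bullet> x = c s}"
  have projE: "x - r x \<in> E" if "x \<in> H" for x
    using add_direction_space[OF H that subspace_neg[OF sU rU]]
    by (simp add: E_def inner_diff_right sr)
  define p where "p = q - r q"
  have pE: "p \<in> E" and pH: "p \<in> H"
    using projE[OF q] by (auto simp: p_def E_def)
  have affE: "affine E"
  proof -
    have "E = H \<inter> (\<Inter>s\<in>S. {x. s \<bullet> x = c s})"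
      by (auto simp: E_def)
    then show ?thesis
      using H by (auto intro!: affine_Int affine_Inter affine_hyperplane)
  qed
  \<comment> \<open>The directions of \<open>E\<close> turn out to be those of \<open>H\<close>
    orthogonal to \<open>S\<close>; the dimension formula for orthogonal complements then gives
    codimension \<open>j\<close>.\<close>
  let ?M = "{y \<in> ?U. \<forall>x\<in>span S. orthogonal x y}"
  have dirE: "direction_space E = ?M"
  proof (intro equalityI subsetI)
    fix z assume "z \<in> direction_space E"
    then obtain x y where z: "z = x - y" "x \<in> E" "y \<in> E"
      by (auto simp: direction_space_def)
    then have "z \<in> ?U"
      by (auto simp: E_def direction_space_def)
    moreover have "\<And>s. s \<in> S \<Longrightarrow> orthogonal s z"
      using z by (auto simp: orthogonal_def E_def inner_diff_right)
    then have "\<And>s. s \<in> span S \<Longrightarrow> orthogonal s z"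
      by (metis orthogonal_commute orthogonal_to_span)
    ultimately show "z \<in> ?M" by auto
  next
    fix z assume z: "z \<in> ?M"
    have "p + z \<in> E"
      using z pE add_direction_space[OF H pH, of z]
      by (auto simp: E_def inner_add_right orthogonal_def span_base)
    then show "z \<in> direction_space E"
      using pE unfolding direction_space_def by (intro CollectI exI[of _ "p + z"] exI[of _ p]) auto
  qed
  have "span S \<subseteq> ?U"
    using S(4) sU by (rule span_minimal)
  then have "dim ?M + dim (span S) = dim ?U"
    by (intro dim_subspace_orthogonal_to_vectors sU) auto
  moreover have "dim (span S) = j"
    using S(2) dim_eq_card_independent[OF orthonormal_independent[OF S(3)]] by simp
  ultimately have dimE: "aff_dim E = aff_dim H - int j"
    using dim_direction_space[OF affE pE] dim_direction_space[OF H pH] dirE by simp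
  have "\<exists>e b. x = e + \<rho> *\<^sub>R b \<and> e \<in> E \<and> b \<in> cball 0 1 \<inter> ?U" if x: "x \<in> C" for x
  proof (intro exI conjI)
    have "(norm (r x))\<^sup>2 \<le> \<rho>\<^sup>2"
      using le[OF x] unfolding r_def by (simp add: norm_orthonormal_sum[OF S(3,1)])
    then have nr: "norm (r x) \<le> \<rho>"
      using \<rho> by (rule power2_le_imp_le)
    \<comment> \<open>For \<open>\<rho> = 0\<close> the inverse is \<open>0\<close>, and the bound
      on the norm forces \<open>r x = 0\<close>, so the same witnesses serve.\<close>
    then show "x = (x - r x) + \<rho> *\<^sub>R (inverse \<rho> *\<^sub>R r x)"
      by (cases "\<rho> = 0") auto
    show "x - r x \<in> E"
      using projE x C by auto
    have "norm (inverse \<rho> *\<^sub>R r x) \<le> 1"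
      using nr \<rho> by (cases "\<rho> = 0") (auto simp: field_simps)
    then show "inverse \<rho> *\<^sub>R r x \<in> cball 0 1 \<inter> ?U"
      using subspace_scale[OF sU rU] by (auto simp: mem_cball)
  qed
  then show "covered_by_cylinder H j C \<rho>"
    unfolding covered_by_cylinder_def using \<rho> affE dimE
    by (intro conjI exI[of _ E]) (auto simp: E_def)
qed

section \<open>Attainment of the outer radius\<close>

text \<open>If \<open>B\<close> bounds the norms in \<open>C\<close>, then \<open>B\<close> itself
  is an admissible radius, so larger radii can be discarded. What remains is compact, and a
  continuous projection of it to the radius attains its infimum.\<close>

lemma covered_by_cylinder_attained:
  fixes H C :: "(real ^ 'n) set"
  assumes H: "affine H" and C: "C \<subseteq> H" "bounded C" "C \<noteq> {}" and j: "int j \<le> aff_dim H"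
  shows "\<exists>\<rho>. covered_by_cylinder H j C \<rho> \<and> (\<forall>\<sigma>. covered_by_cylinder H j C \<sigma> \<longrightarrow> \<rho> \<le> \<sigma>)"
proof -
  let ?U = "direction_space H"
  obtain q where q: "q \<in> C" "q \<in> H" using C by auto
  have sU: "subspace ?U" and dU: "int (dim ?U) = aff_dim H"
    by (rule subspace_direction_space[OF H q(2)], rule dim_direction_space[OF H q(2)])
  have jU: "j \<le> dim ?U" using j dU by simp
  also have "\<dots> \<le> CARD('n)"
    using dim_subset_UNIV[of ?U] by simp
  finally obtain J :: "'n set" where J: "card J = j"
    using obtain_subset_with_card_n[of j "UNIV :: 'n set"] by auto
  obtain B where B: "\<And>x. x \<in> C \<Longrightarrow> norm x \<le> B" "B > 0"
    using C(2) bounded_pos by metis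
  \<comment> \<open>Orthonormal \<open>j\<close>-tuples become matrices whose rows outside a fixed \<open>j\<close>-set \<open>J\<close> vanish, so that
    compactness is that of closed bounded sets in a Euclidean space.\<close>
  define K :: "(real \<times> (real ^ 'n ^ 'n) \<times> (real ^ 'n)) set" where
    "K = {(\<rho>, s, c). 0 \<le> \<rho> \<and> \<rho> \<le> B \<and> (\<forall>i. s $ i \<in> ?U) \<and>
       (\<forall>i\<in>J. \<forall>k\<in>J. s $ i \<bullet> s $ k = (if i = k then 1 else 0)) \<and>
       (\<forall>i\<in>- J. s $ i = 0 \<and> c $ i = 0) \<and>
       (\<forall>x\<in>C. (\<Sum>i\<in>J. (s $ i \<bullet> x - c $ i)\<^sup>2) \<le> \<rho>\<^sup>2)}"
  have K_covered: "covered_by_cylinder H j C \<rho>" if "(\<rho>, s, c) \<in> K" for \<rho> s c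
  proof -
    have K: "0 \<le> \<rho>" "\<And>i. s $ i \<in> ?U"
       "\<And>i k. i \<in> J \<Longrightarrow> k \<in> J \<Longrightarrow> s $ i \<bullet> s $ k = (if i = k then 1 else 0)"
       "\<And>x. x \<in> C \<Longrightarrow> (\<Sum>i\<in>J. (s $ i \<bullet> x - c $ i)\<^sup>2) \<le> \<rho>\<^sup>2"
      using that by (auto simp: K_def)
    \<comment> \<open>Two equal rows with distinct indices in \<open>J\<close> would have an inner
      product that is both \<open>1\<close> and \<open>0\<close>.\<close>
    have inj: "inj_on (($) s) J"
      by (rule inj_onI) (metis K(3) zero_neq_one)
    \<comment> \<open>Moves the constants from the row indices to the rows themselves, which is
      possible because the rows are distinct.\<close>
    define c' where "c' v = c $ the_inv_into J (($) s) v" for v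
    have c': "c' (s $ i) = c $ i" if "i \<in> J" for i
      using that by (simp add: c'_def the_inv_into_f_f[OF inj])
    have "orthonormal (($) s ` J)"
      by (auto simp: orthonormal_def pairwise_def orthogonal_def norm_eq_1 K(3))
    moreover have "(\<Sum>v\<in>($) s ` J. (v \<bullet> x - c' v)\<^sup>2) \<le> \<rho>\<^sup>2" if "x \<in> C" for x
      using K(4)[OF that] by (simp add: sum.reindex[OF inj] c')
    ultimately show ?thesis
      unfolding covered_by_cylinder_iff[OF H C(1) j K(1)]
      using J card_image[OF inj] K(2)
      by (intro exI[of _ "($) s ` J"] exI[of _ c']) auto
  qed
  have covered_K: "\<exists>s c. (\<rho>, s, c) \<in> K" if cov: "covered_by_cylinder H j C \<rho>" and "\<rho> \<le> B" for \<rho>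
  proof -
    have \<rho>: "0 \<le> \<rho>" using cov by (simp add: covered_by_cylinder_def)
    obtain S c where S: "finite S" "card S = j" "orthonormal S" "S \<subseteq> ?U"
      "\<And>x. x \<in> C \<Longrightarrow> (\<Sum>s\<in>S. (s \<bullet> x - c s)\<^sup>2) \<le> \<rho>\<^sup>2"
      using cov unfolding covered_by_cylinder_iff[OF H C(1) j \<rho>] by auto
    obtain f where f: "bij_betw f J S"
      using S(1,2) J by (metis finite finite_same_card_bij)
    then have fS: "f i \<in> S" if "i \<in> J" for i
      using that by (auto simp: bij_betw_def)
    have "f i \<bullet> f k = (if i = k then 1 else 0)" if "i \<in> J" "k \<in> J" for i k
      using orthonormal_inner[OF S(3) fS[OF that(1)] fS[OF that(2)]] f that
      by (auto simp: bij_betw_def inj_on_def)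
    moreover have "(\<Sum>i\<in>J. (f i \<bullet> x - c (f i))\<^sup>2) \<le> \<rho>\<^sup>2" if "x \<in> C" for x
      using S(5)[OF that] sum.reindex_bij_betw[OF f, of "\<lambda>s. (s \<bullet> x - c s)\<^sup>2"] by simp
    ultimately have "(\<rho>, (\<chi> i. if i \<in> J then f i else 0), (\<chi> i. if i \<in> J then c (f i) else 0)) \<in> K"
      using \<rho> \<open>\<rho> \<le> B\<close> fS S(4) subspace_0[OF sU] by (auto simp: K_def cong: sum.cong)
    then show ?thesis by blast
  qed
  \<comment> \<open>Any \<open>j\<close> orthonormal directions with all constants \<open>0\<close>
    work, by Bessel's inequality.\<close>
  have covB: "covered_by_cylinder H j C B"
  proof -
    obtain S0 where S0: "S0 \<subseteq> ?U" "orthonormal S0" "finite S0" "card S0 = dim ?U"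
      using subspace_orthonormal_basis[OF sU] by metis
    obtain S where S: "S \<subseteq> S0" "card S = j"
      using obtain_subset_with_card_n jU S0(4) by metis
    have oS: "orthonormal S" "finite S"
      using S S0 orthonormal_subset finite_subset by auto
    have "(\<Sum>s\<in>S. (s \<bullet> x - 0)\<^sup>2) \<le> B\<^sup>2" if "x \<in> C" for x
      using bessel_inequality[OF oS, of x] B(1)[OF that]
      by (simp) (meson norm_ge_zero order_trans power_mono)
    then show ?thesis
      unfolding covered_by_cylinder_iff[OF H C(1) j less_imp_le[OF B(2)]]
      using oS S S0 by (intro exI[of _ S] exI[of _ "\<lambda>_. 0"]) auto
  qed
  have "closed K"
  proof -
    have "closed {z :: real \<times> (real ^ 'n ^ 'n) \<times> (real ^ 'n). fst (snd z) $ i \<in> ?U}" for i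
      using closed_vimage[OF closed_subspace[OF sU],
          of "\<lambda>z :: real \<times> (real ^ 'n ^ 'n) \<times> (real ^ 'n). fst (snd z) $ i"]
      by (simp add: vimage_def continuous_intros)
    then show ?thesis
      unfolding K_def case_prod_unfold Ball_def
      by (intro closed_Collect_conj closed_Collect_all closed_Collect_imp open_Collect_const
          closed_Collect_le closed_Collect_eq continuous_intros)
  qed
  moreover have "bounded K"
  proof -
    have "norm s \<le> real CARD('n) \<and> norm c \<le> real CARD('n) * (2 * B)"
      and "\<rho> \<in> {0..B}" if "(\<rho>, s, c) \<in> K" for \<rho> s c
    proof -
      have K: "0 \<le> \<rho>" "\<rho> \<le> B" "\<And>i. i \<in> J \<Longrightarrow> norm (s $ i) = 1"
        "\<And>i. i \<notin> J \<Longrightarrow> s $ i = 0" "\<And>i. i \<notin> J \<Longrightarrow> c $ i = 0"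
        "(\<Sum>i\<in>J. (s $ i \<bullet> q - c $ i)\<^sup>2) \<le> \<rho>\<^sup>2"
        using that q(1) by (auto simp: K_def norm_eq_1)
      show "\<rho> \<in> {0..B}" using K by simp
      have s1: "norm (s $ i) \<le> 1" for i
        using K(3,4)[of i] by (cases "i \<in> J") auto
      have "norm s \<le> (\<Sum>i\<in>UNIV. norm (s $ i))"
        unfolding norm_vec_def by (rule L2_set_le_sum) simp
      also have "\<dots> \<le> (\<Sum>i\<in>(UNIV :: 'n set). 1)"
        by (intro sum_mono s1)
      finally have ns: "norm s \<le> real CARD('n)" by simp
      \<comment> \<open>One copy of \<open>B\<close> bounds \<open>s $ i \<bullet> q\<close> by
        Cauchy-Schwarz, the other bounds its difference from \<open>c $ i\<close>, which is at most
        \<open>\<rho>\<close>. The fixed point \<open>q\<close> of \<open>C\<close> is what keeps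
        the constants bounded.\<close>
      have c1: "\<bar>c $ i\<bar> \<le> 2 * B" for i
      proof (cases "i \<in> J")
        case True
        have "(s $ i \<bullet> q - c $ i)\<^sup>2 \<le> (\<Sum>i\<in>J. (s $ i \<bullet> q - c $ i)\<^sup>2)"
          using True by (intro member_le_sum) auto
        then have "(s $ i \<bullet> q - c $ i)\<^sup>2 \<le> \<rho>\<^sup>2"
          using K(6) by simp
        then have "\<bar>s $ i \<bullet> q - c $ i\<bar> \<le> \<rho>"
          using K(1) by (simp add: abs_le_square_iff[symmetric])
        moreover have "\<bar>s $ i \<bullet> q\<bar> \<le> 1 * B"
          using Cauchy_Schwarz_ineq2[of "s $ i" q] K(3)[OF True] B(1)[OF q(1)] by simp
        ultimately show ?thesis using K(2) by simp
      qed (use K(5) B(2) in auto)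
      have "norm c \<le> (\<Sum>i\<in>UNIV. \<bar>c $ i\<bar>)"
        by (rule norm_le_l1_cart)
      also have "\<dots> \<le> (\<Sum>i\<in>(UNIV :: 'n set). 2 * B)"
        by (intro sum_mono c1)
      finally show "norm s \<le> real CARD('n) \<and> norm c \<le> real CARD('n) * (2 * B)"
        using ns by simp
    qed
    then have "K \<subseteq> {0..B} \<times> cball 0 (real CARD('n)) \<times> cball 0 (real CARD('n) * (2 * B))"
      by (auto simp: mem_cball)
    then show ?thesis
      by (rule bounded_subset[rotated]) (intro bounded_Times bounded_cball bounded_closed_interval)
  qed
  ultimately have "compact (fst ` K)"
    by (intro compact_continuous_image continuous_intros) (simp add: compact_eq_bounded_closed)
  moreover have "fst ` K \<noteq> {}"
    using covered_K[OF covB] by auto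
  ultimately obtain \<rho> where \<rho>: "\<rho> \<in> fst ` K" "\<And>\<sigma>. \<sigma> \<in> fst ` K \<Longrightarrow> \<rho> \<le> \<sigma>"
    using compact_attains_inf by metis
  obtain s c where sc: "(\<rho>, s, c) \<in> K" using \<rho>(1) by auto
  \<comment> \<open>Radii up to \<open>B\<close> are represented in \<open>K\<close>; any other
    exceeds \<open>B\<close>, hence also \<open>\<rho>\<close>.\<close>
  have "\<rho> \<le> \<sigma>" if "covered_by_cylinder H j C \<sigma>" for \<sigma>
  proof (cases "\<sigma> \<le> B")
    case True
    then show ?thesis using covered_K[OF that] \<rho>(2) by force
  next
    case False
    then show ?thesis using sc by (auto simp: K_def)
  qed
  then show ?thesis
    using K_covered[OF sc] by blast
qed

lemma outer_radius_eq_Least: "outer_radius H j C = (LEAST \<rho>. covered_by_cylinder H j C \<rho>)"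
  by (simp add: outer_radius_def covered_by_cylinder_def)

text \<open>Attainment lets \<open>Least_equality\<close> identify the outer radius with an
  admissible value. Admissibility and minimality are all that the final argument uses about
  it.\<close>

lemma covered_by_cylinder_outer_radius:
  fixes H C :: "(real ^ 'n) set"
  assumes "affine H" "C \<subseteq> H" "bounded C" "C \<noteq> {}" "int j \<le> aff_dim H"
  shows "covered_by_cylinder H j C (outer_radius H j C)"
    and "covered_by_cylinder H j C \<sigma> \<Longrightarrow> outer_radius H j C \<le> \<sigma>"
proof -
  obtain \<rho> where \<rho>: "covered_by_cylinder H j C \<rho>"
    "\<And>\<sigma>. covered_by_cylinder H j C \<sigma> \<Longrightarrow> \<rho> \<le> \<sigma>"
    using covered_by_cylinder_attained[OF assms] by blast
  then have "outer_radius H j C = \<rho>"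
    unfolding outer_radius_eq_Least by (intro Least_equality)
  with \<rho> show "covered_by_cylinder H j C (outer_radius H j C)"
    and "covered_by_cylinder H j C \<sigma> \<Longrightarrow> outer_radius H j C \<le> \<sigma>"
    by auto
qed

section \<open>The regular simplex: its hyperplane and the reduction to vertices\<close>

text \<open>The set is the preimage of a ball under the linear map onto the span of
  \<open>S\<close>. Convexity is needed to pass from the vertices of the simplex to their
  hull.\<close>

lemma convex_orthonormal_cylinder:
  fixes S :: "'a::real_inner set"
  assumes "orthonormal S" "finite S"
  shows "convex {x. (\<Sum>s\<in>S. (s \<bullet> x - c s)\<^sup>2) \<le> \<rho>\<^sup>2}"
proof -
  let ?g = "\<lambda>x. \<Sum>s\<in>S. (s \<bullet> x) *\<^sub>R s"
  have "linear ?g"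
    by (intro linearI)
      (simp_all add: inner_add_right scaleR_add_left sum.distrib scaleR_sum_right)
  moreover have "{x. (\<Sum>s\<in>S. (s \<bullet> x - c s)\<^sup>2) \<le> \<rho>\<^sup>2} = ?g -` cball (\<Sum>s\<in>S. c s *\<^sub>R s) \<bar>\<rho>\<bar>"
  proof -
    have "(\<Sum>s\<in>S. (s \<bullet> x - c s)\<^sup>2) = (norm (?g x - (\<Sum>s\<in>S. c s *\<^sub>R s)))\<^sup>2" for x
      using norm_orthonormal_sum[OF assms, of "\<lambda>s. s \<bullet> x - c s"]
      by (simp add: scaleR_diff_left sum_subtractf)
    then show ?thesis
      by (auto simp: dist_norm norm_minus_commute abs_le_square_iff[symmetric])
  qed
  ultimately show ?thesis
    by (simp add: convex_linear_vimage)
qed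

lemma simplex_hyperplane_eq: "simplex_hyperplane = {x :: real ^ 'n. (\<chi> k. 1) \<bullet> x = 1}"
  by (simp add: simplex_hyperplane_def inner_vec_def)

lemma affine_simplex_hyperplane: "affine (simplex_hyperplane :: (real ^ 'n) set)"
  unfolding simplex_hyperplane_eq by (rule affine_hyperplane)

lemma aff_dim_simplex_hyperplane:
  "aff_dim (simplex_hyperplane :: (real ^ 'n) set) = int CARD('n) - 1"
proof -
  have "(\<chi> k. 1) \<noteq> (0 :: real ^ 'n)"
    by (simp add: vec_eq_iff)
  then show ?thesis
    unfolding simplex_hyperplane_eq by (simp add: aff_dim_hyperplane)
qed

lemma axis_in_simplex_hyperplane: "axis k 1 \<in> simplex_hyperplane"
  by (simp add: simplex_hyperplane_def axis_def)

lemma direction_space_simplex_hyperplane: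
  "direction_space simplex_hyperplane = {x :: real ^ 'n. (\<Sum>k\<in>UNIV. x $ k) = 0}"
proof -
  \<comment> \<open>Only fixes some index, so that the vertex \<open>axis k 1\<close> can serve as
    base point.\<close>
  obtain k :: 'n where True by simp
  have "x \<in> direction_space simplex_hyperplane" if "(\<Sum>k\<in>UNIV. x $ k) = 0" for x :: "real ^ 'n"
    unfolding direction_space_def using that axis_in_simplex_hyperplane[of k]
    by (intro CollectI exI[of _ "axis k 1 + x"] exI[of _ "axis k 1"])
      (auto simp: simplex_hyperplane_def sum.distrib)
  then show ?thesis
    by (auto simp: direction_space_def simplex_hyperplane_def sum_subtractf)
qed

lemma regular_simplex_subset_hyperplane: "regular_simplex \<subseteq> simplex_hyperplane"
  unfolding regular_simplex_def
  by (intro hull_minimal affine_imp_convex affine_simplex_hyperplane)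
    (auto simp: axis_in_simplex_hyperplane)

text \<open>A convex cylinder contains the simplex as soon as it contains the vertices, and
  \<open>s \<bullet> axis k 1\<close> is the coordinate \<open>s $ k\<close>.\<close>

lemma regular_simplex_covered_iff:
  assumes "j < CARD('n::finite)" "0 \<le> \<rho>"
  shows "covered_by_cylinder simplex_hyperplane j (regular_simplex :: (real ^ 'n) set) \<rho> \<longleftrightarrow>
    (\<exists>S c. finite S \<and> card S = j \<and> orthonormal S \<and> (\<forall>s\<in>S. (\<Sum>k\<in>UNIV. s $ k) = 0) \<and>
       (\<forall>k::'n. (\<Sum>s\<in>S. (s $ k - c s)\<^sup>2) \<le> \<rho>\<^sup>2))"
proof -
  have "(\<forall>x\<in>regular_simplex. (\<Sum>s\<in>S. (s \<bullet> x - c s)\<^sup>2) \<le> \<rho>\<^sup>2) \<longleftrightarrow>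
      (\<forall>k::'n. (\<Sum>s\<in>S. (s $ k - c s)\<^sup>2) \<le> \<rho>\<^sup>2)"
    if "orthonormal S" "finite S" for S :: "(real ^ 'n) set" and c
  proof -
    let ?Z = "{x. (\<Sum>s\<in>S. (s \<bullet> x - c s)\<^sup>2) \<le> \<rho>\<^sup>2}"
    have "regular_simplex \<subseteq> ?Z \<longleftrightarrow> range (\<lambda>k::'n. axis k 1) \<subseteq> ?Z"
      unfolding regular_simplex_def by (rule subset_hull) (rule convex_orthonormal_cylinder[OF that])
    then show ?thesis
      by (simp add: subset_eq inner_axis)
  qed
  moreover have j: "int j \<le> aff_dim (simplex_hyperplane :: (real ^ 'n) set)"
    using assms(1) by (simp add: aff_dim_simplex_hyperplane)
  ultimately show ?thesis
    unfolding covered_by_cylinder_iff[OF affine_simplex_hyperplane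
        regular_simplex_subset_hyperplane j assms(2)]
      direction_space_simplex_hyperplane subset_iff mem_Collect_eq
    by (simp add: Ball_def cong: conj_cong)
qed

section \<open>Total squared distance of the vertices and the bound on the radius\<close>

text \<open>After swapping the sums and expanding the square, each \<open>s\<close> contributes its
  squared norm \<open>1\<close>, the cross term vanishes with the coordinate sum, and
  \<open>(c s)\<^sup>2\<close> is counted once per vertex.\<close>

lemma sum_orthonormal_shifted_coordinates:
  fixes S :: "(real ^ 'n) set"
  assumes "orthonormal S" "\<forall>s\<in>S. (\<Sum>k\<in>UNIV. s $ k) = 0"
  shows "(\<Sum>k\<in>UNIV. \<Sum>s\<in>S. (s $ k - c s)\<^sup>2) = real (card S) + real CARD('n) * (\<Sum>s\<in>S. (c s)\<^sup>2)"
proof -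
  have "(\<Sum>k\<in>UNIV. (s $ k - c s)\<^sup>2) = 1 + real CARD('n) * (c s)\<^sup>2" if "s \<in> S" for s
  proof -
    have "(\<Sum>k\<in>UNIV. (s $ k)\<^sup>2) = 1"
      using orthonormal_inner[OF assms(1) that that] by (simp add: inner_vec_def power2_eq_square)
    moreover have "(\<Sum>k\<in>UNIV. 2 * s $ k * c s) = 2 * c s * (\<Sum>k\<in>UNIV. s $ k)"
      by (simp add: sum_distrib_left algebra_simps)
    ultimately show ?thesis
      using assms(2) that by (simp add: power2_diff sum.distrib sum_subtractf)
  qed
  then have "(\<Sum>s\<in>S. \<Sum>k\<in>UNIV. (s $ k - c s)\<^sup>2) = (\<Sum>s\<in>S. 1 + real CARD('n) * (c s)\<^sup>2)"
    by (rule sum.cong[OF refl])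
  then show ?thesis
    by (subst sum.swap) (simp add: sum.distrib sum_distrib_left)
qed

theorem theorem2p5:
  fixes d j :: nat
  assumes "CARD('n::finite) = d + 1"
    and "d \<ge> 2"
    and "j \<in> {1..d}"
  shows "outer_radius simplex_hyperplane j (regular_simplex :: (real ^ 'n) set)
           \<ge> sqrt (real j / real (d + 1)) \<and>
         (outer_radius simplex_hyperplane j (regular_simplex :: (real ^ 'n) set)
            = sqrt (real j / real (d + 1))
          \<longleftrightarrow> (\<exists>S :: (real ^ 'n) set. good_subset_basis j S))"
proof -
  let ?H = "simplex_hyperplane :: (real ^ 'n) set" and ?T = "regular_simplex :: (real ^ 'n) set"
  let ?R = "outer_radius ?H j ?T"
  have jn: "j < CARD('n)" using assms by simp
  have "bounded ?T"
    unfolding regular_simplex_def by (intro bounded_convex_hull finite_imp_bounded) simp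
  moreover have "?T \<noteq> {}"
    unfolding regular_simplex_def by simp
  moreover have "int j \<le> aff_dim ?H"
    using jn by (simp add: aff_dim_simplex_hyperplane)
  ultimately have R: "covered_by_cylinder ?H j ?T ?R"
    and R_le: "\<And>\<sigma>. covered_by_cylinder ?H j ?T \<sigma> \<Longrightarrow> ?R \<le> \<sigma>"
    using covered_by_cylinder_outer_radius[OF affine_simplex_hyperplane
        regular_simplex_subset_hyperplane] by auto
  have R0: "0 \<le> ?R"
    using R by (simp add: covered_by_cylinder_def)
  \<comment> \<open>An optimal flat in coordinates: summing its bounds \<open>le\<close> over all
    \<open>d + 1\<close> vertices and comparing with the exact total gives the lower bound.\<close>
  obtain S :: "(real ^ 'n) set" and c where S: "finite S" "card S = j" "orthonormal S"
    "\<forall>s\<in>S. (\<Sum>k\<in>UNIV. s $ k) = 0"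
    and le: "\<And>k. (\<Sum>s\<in>S. (s $ k - c s)\<^sup>2) \<le> ?R\<^sup>2"
    using R unfolding regular_simplex_covered_iff[OF jn R0] by auto
  have tot: "(\<Sum>k\<in>UNIV. \<Sum>s\<in>S. (s $ k - c s)\<^sup>2) = real j + real (d + 1) * (\<Sum>s\<in>S. (c s)\<^sup>2)"
    using sum_orthonormal_shifted_coordinates[OF S(3,4), of c] S(2) assms(1) by simp
  have "(\<Sum>k\<in>UNIV. \<Sum>s\<in>S. (s $ k - c s)\<^sup>2) \<le> (\<Sum>k\<in>(UNIV :: 'n set). ?R\<^sup>2)"
    by (intro sum_mono le)
  then have up: "real j + real (d + 1) * (\<Sum>s\<in>S. (c s)\<^sup>2) \<le> real (d + 1) * ?R\<^sup>2"
    using tot assms(1) by simp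
  have c0: "0 \<le> (\<Sum>s\<in>S. (c s)\<^sup>2)"
    by (intro sum_nonneg) simp
  then have "0 \<le> real (d + 1) * (\<Sum>s\<in>S. (c s)\<^sup>2)"
    by (intro mult_nonneg_nonneg) simp_all
  then have "real j / real (d + 1) \<le> ?R\<^sup>2"
    using up by (simp add: divide_le_eq mult.commute)
  then have lower: "sqrt (real j / real (d + 1)) \<le> ?R"
    using R0 by (intro real_le_lsqrt) auto
  moreover have "\<exists>S :: (real ^ 'n) set. good_subset_basis j S" if eq: "?R = sqrt (real j / real (d + 1))"
  proof -
    have R2: "?R\<^sup>2 = real j / real (d + 1)"
      by (simp add: eq)
    then have nR: "real (d + 1) * ?R\<^sup>2 = real j" by simp
    then have "real (d + 1) * (\<Sum>s\<in>S. (c s)\<^sup>2) \<le> 0"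
      using up by linarith
    then have "(\<Sum>s\<in>S. (c s)\<^sup>2) = 0"
      using c0 by (simp add: mult_le_0_iff)
    then have c: "c s = 0" if "s \<in> S" for s
      using that S(1) by (simp add: sum_nonneg_eq_0_iff)
    \<comment> \<open>With equality the slacks in \<open>le\<close> are nonnegative and add up to
      \<open>0\<close>, so each vanishes and all vertices are equally far from the flat.\<close>
    have "(\<Sum>k\<in>UNIV. ?R\<^sup>2 - (\<Sum>s\<in>S. (s $ k)\<^sup>2)) = 0"
      using tot nR assms(1) by (simp add: sum_subtractf c)
    moreover have "0 \<le> ?R\<^sup>2 - (\<Sum>s\<in>S. (s $ k)\<^sup>2)" for k
      using le[of k] by (simp add: c)
    ultimately have "\<And>k. ?R\<^sup>2 - (\<Sum>s\<in>S. (s $ k)\<^sup>2) = 0"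
      by (subst (asm) sum_nonneg_eq_0_iff) auto
    then have "\<And>k. (\<Sum>s\<in>S. (s $ k)\<^sup>2) = real j / real CARD('n)"
      using R2 assms(1) by simp
    then show ?thesis
      using S assms by (intro exI[of _ S]) (auto simp: good_subset_basis_def orthonormal_def)
  qed
  moreover have "?R = sqrt (real j / real (d + 1))" if gsb: "good_subset_basis j S"
    for S :: "(real ^ 'n) set"
  proof -
    let ?r = "sqrt (real j / real (d + 1))"
    \<comment> \<open>The constants \<open>0\<close> describe a flat through the centroid; the
      defining identity of a good subset basis puts every vertex at squared distance exactly
      \<open>j / (d + 1)\<close> from it.\<close>
    have "covered_by_cylinder ?H j ?T ?r"
      using gsb assms(1)
      by (subst regular_simplex_covered_iff[OF jn]; (intro exI[of _ S] exI[of _ "\<lambda>_. 0"])?)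
        (auto simp: good_subset_basis_def orthonormal_def)
    then show ?thesis
      using R_le lower by (intro antisym) auto
  qed
  ultimately show ?thesis by blast
qed

end
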